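(* Let $T$ be a forward expansive correspondence on a compact metric space $X$, let $\psi\in C(\Gamma_T,\mathbb{R})$, and suppose that $(T,\psi)$ satisfies the $C^\omega$ Legendre assumptions and has unique linear equilibrium pairs. Let $F$ be real analytic on an open neighborhood of the convex hull of $\psi(\Gamma_T)$, put $\mathcal{E}(\gamma)=F(\int_{\Gamma_T}\psi\,d\gamma)$ for $\gamma\in\mathcal{M}(\Gamma_T)$, and assume that $(T,\mathcal{E})$ has an abundance of ergodic path measures. Then there are only finitely many nonlinear equilibrium values and only finitely many nonlinear equilibrium pairs, and hence only finitely many two-coordinate distributions $\gamma_{\mu,Q}$ of nonlinear equilibrium pairs.
   Context: For a compact metric space $Y$, $\mathcal{M}(Y)$ is the set of Borel probability measures on $Y$ with the weak-star topology. For $S:Y\to Y$ continuous, $\mathcal{M}(Y,S)$ is the set of $S$-invariant elements of $\mathcal{M}(Y)$ and $h_\nu(S)$ is Kolmogorov--Sinai entropy. Logarithms are natural. Correspondences. Let $(X,d)$ be a compact metric space. A correspondence $T$ on $X$ assigns to each $x\in X$ a nonempty closed set $T(x)\subset X$ such that $\Gamma_T=\{(x,y)\in X^2:y\in T(x)\}$ is closed in $X^2$. Set $\mathcal{O}_{n+1}(T)=\{(x_0,\dots,x_n)\in X^{n+1}:x_{j+1}\in T(x_j),\ 0\le j<n\}$ with metric $d_{n+1}(\boldsymbol{x},\boldsymbol{y})=\max_{0\le j\le n}d(x_j,y_j)$. The orbit space is $\Omega_T=\{(x_j)_{j\ge0}:x_{j+1}\in T(x_j)\ \forall j\ge 0\}$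 with the product topology and shift $\sigma((x_j)_{j\geq 0})=(x_{j+1})_{j\geq 0}$. $T$ is forward expansive if there is $\varepsilon_0>0$ such that any two distinct $\boldsymbol{x},\boldsymbol{y}\in\Omega_T$ satisfy $d(x_j,y_j)>\varepsilon_0$ for some $j\ge0$. Stationary transition pairs. $\mathcal{K}(X;T)$ is the set of Borel transition probability kernels $Q$ on $X$ with $\operatorname{supp}Q_x\subseteq T(x)$ for every $x$. $\mathcal{M}(X,Q)=\{\mu\in\mathcal{M}(X):\mu Q=\mu\}$, $(\mu Q)(A)=\int_XQ_x(A)\,d\mu(x)$. A stationary transition pair is $(\mu,Q)$ with $Q\in\mathcal{K}(X;T)$, $\mu\in\mathcal{M}(X,Q)$; its two-coordinate distribution is $\gamma_{\mu,Q}(dx,dy)=\mu(dx)Q_x(dy)$, an element of $\mathcal{M}(\Gamma_T)$. Kernels agreeing $\mu$-almost everywhere are identified, and pairs are counted modulo this identification. Kernel entropy. Let $\mu Q^{[n-1]}$ be the law on $X^n$ of $(x_0,\dots,x_{n-1})$ for the Markov process with initial law $\mu$ and kernel $Q$. For a finite Borel partition $\mathcal{A}$ of $X$ with product partition $\mathcal{A}^{\times n}$, $h_\mu(Q,\mathcal{A})=\lim_{n}\frac1nH_{\mu Q^{[n-1]}}(\mathcal{A}^{\times n})$, where $H_\lambda(\mathcal{B})=-\sum_{B\in\mathcal{B}}\lambda(B)\log\lambda(B)$, and $h_\mu(Q)=\sup_{\mathcal{A}}h_\mu(Q,\mathcal{A})$. A nonlinear equilibrium pair for $\mathcal{E}$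 is a stationary transition pair maximizing $h_\mu(Q)+\mathcal{E}(\gamma_{\mu,Q})$ among all stationary transition pairs; its nonlinear equilibrium value is its rotation value $\int\psi\,d\gamma_{\mu,Q}$. Linear pressure. For $\varphi\in C(\Gamma_T,\mathbb{R})$, $P(T,\varphi)=\lim_{\varepsilon\to0^+}\limsup_n\frac1n\log\sup_{\mathcal{C}}\sum_{\boldsymbol x\in\mathcal{C}}\exp\bigl(\sum_{j=0}^{n-1}\varphi(x_j,x_{j+1})\bigr)$, the supremum over $\mathcal{C}\subset\mathcal{O}_{n+1}(T)$ whose distinct elements are at $d_{n+1}$-distance greater than $\varepsilon$; for forward expansive $T$ it equals $\sup\{h_\mu(Q)+\int\varphi\,d\gamma_{\mu,Q}\}$ over stationary transition pairs, and $\mathsf{Eq}(T,\varphi)$ is the set of pairs attaining this supremum (linear equilibrium pairs). $(T,\psi)$ has unique linear equilibrium pairs if $\mathsf{Eq}(T,y\psi)$ consists of exactly one pair (modulo the identification above) for every $y\in\mathbb{R}$. Abundance. Let $p_2:\Omega_T\to\Gamma_T$, $p_2((x_j)_{j\geq 0})=(x_0,x_1)$, and $\widehat{\mathcal{E}}(\nu)=\mathcal{E}((p_2)_*\nu)$. $(T,\mathcal{E})$ has an abundance of ergodic path measures if for every $\nu\in\mathcal{M}(\Omega_T,\sigma)$ and $\eta>0$ there is an ergodic $\rho\in\mathcal{M}(\Omega_T,\sigma)$ with $h_\rho(\sigma)+\widehat{\mathcal{E}}(\rho)>h_\nu(\sigma)+\widehat{\mathcal{E}}(\nu)-\eta$.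 Rotation set and localized entropy. $\mathcal{R}(\psi)=\{\int\psi\,d\gamma_{\mu,Q}:(\mu,Q)\text{ stationary transition pair}\}\subset\mathbb{R}$; for $z\in\mathcal{R}(\psi)$, $\mathfrak{h}(z)=\sup\{h_\mu(Q):\int\psi\,d\gamma_{\mu,Q}=z\}$. Put $P(y)=P(T,y\psi)$, $y\in\mathbb{R}$. $C^\omega$ Legendre assumptions for $(T,\psi)$: (i) $\mathcal{R}(\psi)$ has nonempty interior; (ii) $\mathfrak{h}$ is finite and upper semicontinuous on $\mathcal{R}(\psi)$, and is real analytic and strictly concave on its interior; (iii) $P$ is real analytic and strictly convex, and $P':\mathbb{R}\to\operatorname{int}\mathcal{R}(\psi)$ is a homeomorphism such that it and its inverse are real analytic; (iv) $\mathfrak{h}(z)=\inf_{y\in\mathbb{R}}(P(y)-yz)$ for all $z\in\mathcal{R}(\psi)$. *)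

theory Defs
  imports "HOL-Probability.Probability"
begin

text \<open>
  A compact metric space is rendered as a type of class \<open>polish_space\<close> whose universe is
  compact. Every compact metric space is complete and second countable, so the class excludes
  nothing; it makes the Borel structure of products available.
\<close>

section \<open>Real functions\<close>

definition real_analytic_on :: "(real \<Rightarrow> real) \<Rightarrow> real set \<Rightarrow> bool" where
  "real_analytic_on f U \<longleftrightarrow>
     (\<forall>x\<in>U. \<exists>r>0. \<exists>a :: nat \<Rightarrow> real. \<forall>y\<in>ball x r. (\<lambda>n. a n * (y - x) ^ n) sums f y)"

definition strictly_convex_on :: "real set \<Rightarrow> (real \<Rightarrow> real) \<Rightarrow> bool" where
  "strictly_convex_on S f \<longleftrightarrow> convex S \<and>
     (\<forall>x\<in>S. \<forall>y\<in>S. \<forall>t. x \<noteq> y \<longrightarrow> 0 < t \<longrightarrow> t < 1 \<longrightarrow>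
        f ((1 - t) * x + t * y) < (1 - t) * f x + t * f y)"

definition strictly_concave_on :: "real set \<Rightarrow> (real \<Rightarrow> real) \<Rightarrow> bool" where
  "strictly_concave_on S f \<longleftrightarrow> strictly_convex_on S (\<lambda>x. - f x)"

definition usc_on :: "'a::topological_space set \<Rightarrow> ('a \<Rightarrow> ereal) \<Rightarrow> bool" where
  "usc_on S f \<longleftrightarrow> (\<forall>x\<in>S. \<forall>c>f x. \<forall>\<^sub>F y in at x within S. f y < c)"

section \<open>Measures and entropy\<close>

definition borel_probs :: "'a::topological_space set \<Rightarrow> 'a measure set" where
  "borel_probs Y = {\<nu>. prob_space \<nu> \<and> sets \<nu> = sets (restrict_space borel Y)}"

definition invariant_probs ::
    "'a::topological_space set \<Rightarrow> ('a \<Rightarrow> 'a) \<Rightarrow> 'a measure set" where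
  "invariant_probs Y S = {\<nu> \<in> borel_probs Y. distr \<nu> \<nu> S = \<nu>}"

definition ergodic :: "'a measure \<Rightarrow> ('a \<Rightarrow> 'a) \<Rightarrow> bool" where
  "ergodic \<nu> S \<longleftrightarrow>
     (\<forall>A\<in>sets \<nu>. S -` A \<inter> space \<nu> = A \<longrightarrow> measure \<nu> A = 0 \<or> measure \<nu> A = 1)"

definition measure_support :: "'a::topological_space measure \<Rightarrow> 'a set" where
  "measure_support \<nu> = {x. \<forall>U. open U \<longrightarrow> x \<in> U \<longrightarrow> 0 < emeasure \<nu> U}"

definition finite_partitions :: "'a measure \<Rightarrow> 'a set set set" where
  "finite_partitions M = {A. finite A \<and> A \<subseteq> sets M \<and> partition_on (space M) A}"

text \<open>The convention \<open>0 log 0 = 0\<close> holds automatically.\<close>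

definition partition_entropy :: "'a measure \<Rightarrow> 'a set set \<Rightarrow> real" where
  "partition_entropy M A = - (\<Sum>B\<in>A. measure M B * ln (measure M B))"

text \<open>The join of the preimages of \<open>A\<close> under \<open>S\<^sup>0, \<dots>, S\<^sup>n\<close>.\<close>

definition iterated_join :: "'a measure \<Rightarrow> ('a \<Rightarrow> 'a) \<Rightarrow> 'a set set \<Rightarrow> nat \<Rightarrow> 'a set set" where
  "iterated_join M S A n =
     (\<lambda>B. {x \<in> space M. \<forall>i\<le>n. (S ^^ i) x \<in> B i}) ` ({..n} \<rightarrow>\<^sub>E A) - {{}}"

definition ks_entropy_partition :: "'a measure \<Rightarrow> ('a \<Rightarrow> 'a) \<Rightarrow> 'a set set \<Rightarrow> real" where
  "ks_entropy_partition M S A =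
     lim (\<lambda>n. partition_entropy M (iterated_join M S A n) / real (Suc n))"

definition ks_entropy :: "'a measure \<Rightarrow> ('a \<Rightarrow> 'a) \<Rightarrow> ereal" where
  "ks_entropy M S = (SUP A\<in>finite_partitions M. ereal (ks_entropy_partition M S A))"

section \<open>Correspondences\<close>

definition graph :: "('a \<Rightarrow> 'a set) \<Rightarrow> ('a \<times> 'a) set" where
  "graph T = {(x, y). y \<in> T x}"

definition correspondence :: "('a::topological_space \<Rightarrow> 'a set) \<Rightarrow> bool" where
  "correspondence T \<longleftrightarrow> (\<forall>x. T x \<noteq> {} \<and> closed (T x)) \<and> closed (graph T)"

definition orbit_space :: "('a \<Rightarrow> 'a set) \<Rightarrow> (nat \<Rightarrow> 'a) set" where
  "orbit_space T = {x. \<forall>j. x (Suc j) \<in> T (x j)}"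

definition orbit_shift :: "(nat \<Rightarrow> 'a) \<Rightarrow> (nat \<Rightarrow> 'a)" where
  "orbit_shift x = (\<lambda>j. x (Suc j))"

definition forward_expansive :: "('a::metric_space \<Rightarrow> 'a set) \<Rightarrow> bool" where
  "forward_expansive T \<longleftrightarrow>
     (\<exists>\<epsilon>\<^sub>0>0. \<forall>x\<in>orbit_space T. \<forall>y\<in>orbit_space T. x \<noteq> y \<longrightarrow> (\<exists>j. \<epsilon>\<^sub>0 < dist (x j) (y j)))"

text \<open>
  A point \<open>(x\<^sub>0, \<dots>, x\<^sub>n)\<close> is an extensional function on \<open>{..n}\<close>; thus \<open>finite_orbits T n\<close> is
  the set of orbit segments with \<open>n\<close> steps and \<open>n + 1\<close> points.
\<close>

definition finite_orbits :: "('a \<Rightarrow> 'a set) \<Rightarrow> nat \<Rightarrow> (nat \<Rightarrow> 'a) set" where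
  "finite_orbits T n = {x \<in> {..n} \<rightarrow>\<^sub>E UNIV. \<forall>j<n. x (Suc j) \<in> T (x j)}"

definition orbit_dist :: "nat \<Rightarrow> (nat \<Rightarrow> 'a::metric_space) \<Rightarrow> (nat \<Rightarrow> 'a) \<Rightarrow> real" where
  "orbit_dist n x y = (MAX j\<in>{..n}. dist (x j) (y j))"

definition separated_sets ::
    "('a::metric_space \<Rightarrow> 'a set) \<Rightarrow> nat \<Rightarrow> real \<Rightarrow> (nat \<Rightarrow> 'a) set set" where
  "separated_sets T n \<epsilon> =
     {C. C \<subseteq> finite_orbits T n \<and> (\<forall>x\<in>C. \<forall>y\<in>C. x \<noteq> y \<longrightarrow> \<epsilon> < orbit_dist n x y)}"

text \<open>
  On a compact space separated sets are finite, with a cardinality bound depending only on \<open>n\<close>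
  and \<open>\<epsilon>\<close>, so the sums and the real supremum below are genuine for continuous potentials.
\<close>

definition linear_pressure ::
    "('a::metric_space \<Rightarrow> 'a set) \<Rightarrow> ('a \<times> 'a \<Rightarrow> real) \<Rightarrow> ereal" where
  "linear_pressure T \<phi> =
     Lim (at_right 0) (\<lambda>\<epsilon>. limsup (\<lambda>n. ereal (1 / real n *
       ln (SUP C\<in>separated_sets T n \<epsilon>. \<Sum>x\<in>C. exp (\<Sum>j<n. \<phi> (x j, x (Suc j)))))))"

section \<open>Stationary transition pairs\<close>

definition transition_kernels ::
    "('a::topological_space \<Rightarrow> 'a set) \<Rightarrow> ('a \<Rightarrow> 'a measure) set" where
  "transition_kernels T =
     {Q \<in> borel \<rightarrow>\<^sub>M prob_algebra borel. \<forall>x. measure_support (Q x) \<subseteq> T x}"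

definition stationary_pairs ::
    "('a::topological_space \<Rightarrow> 'a set) \<Rightarrow> ('a measure \<times> ('a \<Rightarrow> 'a measure)) set" where
  "stationary_pairs T =
     {(\<mu>, Q). Q \<in> transition_kernels T \<and> \<mu> \<in> borel_probs UNIV \<and> \<mu> \<bind> Q = \<mu>}"

text \<open>Counting pairs modulo the identification means counting classes of this relation.\<close>

definition pair_equiv ::
    "('a::topological_space \<Rightarrow> 'a set) \<Rightarrow> ('a measure \<times> ('a \<Rightarrow> 'a measure)) rel" where
  "pair_equiv T =
     {((\<mu>, Q), (\<mu>', Q')). (\<mu>, Q) \<in> stationary_pairs T \<and> (\<mu>', Q') \<in> stationary_pairs T \<and>
        \<mu> = \<mu>' \<and> (AE x in \<mu>. Q x = Q' x)}"

text \<open>The measure \<open>\<mu>(dx) Q\<^sub>x(dy)\<close>, regarded as a measure on the graph of \<open>T\<close>.\<close>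

definition two_coord ::
    "('a::topological_space \<Rightarrow> 'a set) \<Rightarrow> 'a measure \<Rightarrow> ('a \<Rightarrow> 'a measure) \<Rightarrow> ('a \<times> 'a) measure"
  where
  "two_coord T \<mu> Q =
     restrict_space (\<mu> \<bind> (\<lambda>x. distr (Q x) borel (\<lambda>y. (x, y)))) (graph T)"

text \<open>The law of \<open>(x\<^sub>0, \<dots>, x\<^sub>n)\<close> for the Markov process with initial law \<open>\<mu>\<close> and kernel \<open>Q\<close>.\<close>

primrec markov_law ::
    "'a::topological_space measure \<Rightarrow> ('a \<Rightarrow> 'a measure) \<Rightarrow> nat \<Rightarrow> (nat \<Rightarrow> 'a) measure" where
  "markov_law \<mu> Q 0 = distr \<mu> (Pi\<^sub>M {..0} (\<lambda>_. borel)) (\<lambda>x. \<lambda>i\<in>{..0}. x)"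
| "markov_law \<mu> Q (Suc n) =
     markov_law \<mu> Q n \<bind>
       (\<lambda>w. distr (Q (w n)) (Pi\<^sub>M {..Suc n} (\<lambda>_. borel)) (\<lambda>y. w(Suc n := y)))"

definition product_partition :: "nat set \<Rightarrow> 'a set set \<Rightarrow> (nat \<Rightarrow> 'a) set set" where
  "product_partition I A = (\<lambda>B. Pi\<^sub>E I B) ` (I \<rightarrow>\<^sub>E A)"

definition kernel_entropy_partition ::
    "'a::topological_space measure \<Rightarrow> ('a \<Rightarrow> 'a measure) \<Rightarrow> 'a set set \<Rightarrow> real" where
  "kernel_entropy_partition \<mu> Q A =
     lim (\<lambda>n. partition_entropy (markov_law \<mu> Q n) (product_partition {..n} A) / real (Suc n))"

definition kernel_entropy ::
    "'a::topological_space measure \<Rightarrow> ('a \<Rightarrow> 'a measure) \<Rightarrow> ereal" where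
  "kernel_entropy \<mu> Q =
     (SUP A\<in>finite_partitions borel. ereal (kernel_entropy_partition \<mu> Q A))"

definition rotation_value ::
    "('a::topological_space \<Rightarrow> 'a set) \<Rightarrow> ('a \<times> 'a \<Rightarrow> real) \<Rightarrow>
     'a measure \<times> ('a \<Rightarrow> 'a measure) \<Rightarrow> real" where
  "rotation_value T \<psi> = (\<lambda>(\<mu>, Q). \<integral>p. \<psi> p \<partial>two_coord T \<mu> Q)"

section \<open>Equilibria and rotation theory\<close>

text \<open>
  The values \<open>h\<^sub>\<mu>(Q) + E(\<gamma>)\<close> are extended reals; entropies are never \<open>-\<infinity>\<close>, so the sums are
  unambiguous.
\<close>

definition nonlinear_equilibrium_pairs ::
    "('a::topological_space \<Rightarrow> 'a set) \<Rightarrow> (('a \<times> 'a) measure \<Rightarrow> real) \<Rightarrow>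
     ('a measure \<times> ('a \<Rightarrow> 'a measure)) set" where
  "nonlinear_equilibrium_pairs T E =
     {(\<mu>, Q) \<in> stationary_pairs T. \<forall>(\<mu>', Q')\<in>stationary_pairs T.
        kernel_entropy \<mu>' Q' + ereal (E (two_coord T \<mu>' Q'))
          \<le> kernel_entropy \<mu> Q + ereal (E (two_coord T \<mu> Q))}"

definition linear_equilibrium_pairs ::
    "('a::topological_space \<Rightarrow> 'a set) \<Rightarrow> ('a \<times> 'a \<Rightarrow> real) \<Rightarrow>
     ('a measure \<times> ('a \<Rightarrow> 'a measure)) set" where
  "linear_equilibrium_pairs T \<phi> =
     {(\<mu>, Q) \<in> stationary_pairs T.
        kernel_entropy \<mu> Q + ereal (\<integral>p. \<phi> p \<partial>two_coord T \<mu> Q) =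
        (SUP (\<mu>', Q')\<in>stationary_pairs T.
           kernel_entropy \<mu>' Q' + ereal (\<integral>p. \<phi> p \<partial>two_coord T \<mu>' Q'))}"

definition unique_linear_equilibrium_pairs ::
    "('a::topological_space \<Rightarrow> 'a set) \<Rightarrow> ('a \<times> 'a \<Rightarrow> real) \<Rightarrow> bool" where
  "unique_linear_equilibrium_pairs T \<psi> \<longleftrightarrow>
     (\<forall>y::real. card (linear_equilibrium_pairs T (\<lambda>p. y * \<psi> p) // pair_equiv T) = 1)"

definition abundance_of_ergodic_path_measures ::
    "('a::topological_space \<Rightarrow> 'a set) \<Rightarrow> (('a \<times> 'a) measure \<Rightarrow> real) \<Rightarrow> bool" where
  "abundance_of_ergodic_path_measures T E \<longleftrightarrow>
     (let E' = (\<lambda>\<nu>. E (distr \<nu> (restrict_space borel (graph T)) (\<lambda>x. (x 0, x 1)))) in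
      \<forall>\<nu>\<in>invariant_probs (orbit_space T) orbit_shift. \<forall>\<eta>>0.
        \<exists>\<rho>\<in>invariant_probs (orbit_space T) orbit_shift. ergodic \<rho> orbit_shift \<and>
          ks_entropy \<rho> orbit_shift + ereal (E' \<rho>)
            > ks_entropy \<nu> orbit_shift + ereal (E' \<nu>) - ereal \<eta>)"

definition rotation_set ::
    "('a::topological_space \<Rightarrow> 'a set) \<Rightarrow> ('a \<times> 'a \<Rightarrow> real) \<Rightarrow> real set" where
  "rotation_set T \<psi> = rotation_value T \<psi> ` stationary_pairs T"

definition localized_entropy ::
    "('a::topological_space \<Rightarrow> 'a set) \<Rightarrow> ('a \<times> 'a \<Rightarrow> real) \<Rightarrow> real \<Rightarrow> ereal" where
  "localized_entropy T \<psi> z =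
     (SUP (\<mu>, Q)\<in>{p \<in> stationary_pairs T. rotation_value T \<psi> p = z}. kernel_entropy \<mu> Q)"

definition legendre_assumptions ::
    "('a::metric_space \<Rightarrow> 'a set) \<Rightarrow> ('a \<times> 'a \<Rightarrow> real) \<Rightarrow> bool" where
  "legendre_assumptions T \<psi> \<longleftrightarrow>
     (let R = rotation_set T \<psi>;
          h = localized_entropy T \<psi>;
          P = (\<lambda>y::real. linear_pressure T (\<lambda>p. y * \<psi> p));
          h\<^sub>r = (\<lambda>z. real_of_ereal (h z));
          P\<^sub>r = (\<lambda>y. real_of_ereal (P y))
      in
        interior R \<noteq> {} \<and>
        (\<forall>z\<in>R. \<bar>h z\<bar> \<noteq> \<infinity>) \<and> usc_on R h \<and>
        real_analytic_on h\<^sub>r (interior R) \<and> strictly_concave_on (interior R) h\<^sub>r \<and>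
        (\<forall>y. \<bar>P y\<bar> \<noteq> \<infinity>) \<and> real_analytic_on P\<^sub>r UNIV \<and> strictly_convex_on UNIV P\<^sub>r \<and>
        (\<exists>g. homeomorphism UNIV (interior R) (deriv P\<^sub>r) g \<and>
             real_analytic_on (deriv P\<^sub>r) UNIV \<and> real_analytic_on g (interior R)) \<and>
        (\<forall>z\<in>R. h z = (INF y. P y - ereal (y * z))))"

end

theory Submission
  imports Defs "HOL-Complex_Analysis.Cauchy_Integral_Formula"
begin

text \<open>
  A nonlinear equilibrium pair with rotation value \<open>z\<close> has the largest kernel entropy among the
  stationary pairs of rotation value \<open>z\<close>, and \<open>z\<close> maximizes \<open>h + F\<close> over the rotation set \<open>R\<close>,
  where \<open>h\<close> is the localized entropy. With \<open>P y\<close> denoting the pressure of \<open>y \<psi>\<close>, the theorem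
  therefore reduces to two facts.

  \<^item> The set of maximizers of \<open>h + F\<close> is finite and lies in the interior of \<open>R\<close>
    (\<open>finite_maximizers\<close>). Legendre duality gives \<open>h z \<le> h w + y (w - z)\<close> for all \<open>z \<in> R\<close> when
    \<open>w = P' y\<close>: the slope of \<open>h\<close> at \<open>P' y\<close> is \<open>- y\<close>, so it becomes arbitrarily steep towards the ends
    of \<open>R\<close>. But \<open>F\<close> is analytic on a neighbourhood of the compact interval spanned by the values
    of \<open>\<psi>\<close>, hence Lipschitz on it with some constant \<open>L\<close>. Consequently no maximizer lies outside
    the compact interval from \<open>P' (- (L + 1))\<close> to \<open>P' (L + 1)\<close>, which is contained in the interior
    of \<open>R\<close>. Were there infinitely many maximizers, they would accumulate inside that interval, and
    the identity theorem for real analytic functions would make \<open>h + F\<close> constant on the interior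
    of \<open>R\<close>; but \<open>P' (- (L + 2))\<close> belongs to the interior and is not a maximizer.

  \<^item> If \<open>z = P' y\<close>, a pair of rotation value \<open>z\<close> and entropy \<open>h z\<close> is a linear equilibrium pair for
    \<open>y \<psi>\<close> (\<open>linear_equilibrium_pairsI\<close>), again by Legendre duality: \<open>h w + y w \<le> P y\<close> for all
    \<open>w \<in> R\<close>, with equality at \<open>w = z\<close>. By uniqueness the nonlinear equilibrium pairs of
    rotation value \<open>z\<close> form at most one equivalence class.

  The two-coordinate distribution depends only on the class of a pair, which gives the last
  assertion.
\<close>

section \<open>Real analytic functions\<close>

lemma real_analytic_on_deriv:
  assumes "real_analytic_on f U" "x \<in> U"
  shows "(f has_real_derivative deriv f x) (at x)" and "isCont (deriv f) x"
proof -
  obtain r a where r: "r > 0" and s: "\<And>y. y \<in> ball x r \<Longrightarrow> (\<lambda>n. a n * (y - x) ^ n) sums f y"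
    using assms unfolding real_analytic_on_def by blast
  define f' where "f' y = (\<Sum>n. diffs a n * (y - x) ^ n)" for y
  have sm: "summable (\<lambda>n. a n * z ^ n)" if "norm z < r" for z
    using s[of "x + z"] that by (auto simp: dist_norm sums_iff)
  have smd: "summable (\<lambda>n. diffs a n * z ^ n)" if "norm z < r" for z
    using termdiff_converges[OF that] sm by blast
  have d: "(f has_real_derivative f' y) (at y)" if "y \<in> ball x r" for y
  proof -
    have "norm (y - x) < r"
      using that by (simp add: dist_norm norm_minus_commute)
    then have "((\<lambda>z. \<Sum>n. a n * z ^ n) has_real_derivative f' y) (at (y - x))"
      unfolding f'_def using sm by (intro termdiffs_strong') auto
    moreover have "((\<lambda>z. z - x) has_real_derivative 1) (at y)"
      by (auto intro!: derivative_eq_intros)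
    ultimately have "((\<lambda>z. \<Sum>n. a n * (z - x) ^ n) has_real_derivative f' y) (at y)"
      using DERIV_chain2[of "\<lambda>z. \<Sum>n. a n * z ^ n" "f' y" "\<lambda>z. z - x" y 1] by simp
    then show ?thesis
      by (rule has_field_derivative_transform_within_open[OF _ open_ball that])
        (use s in \<open>auto simp: sums_iff\<close>)
  qed
  have df: "deriv f y = f' y" if "y \<in> ball x r" for y
    using d[OF that] by (rule DERIV_imp_deriv)
  show "(f has_real_derivative deriv f x) (at x)"
    using d[of x] df[of x] r by simp
  have "isCont (\<lambda>z. \<Sum>n. diffs a n * z ^ n) (x - x)"
    by (rule isCont_powser[of _ "r / 2"]) (use smd[of "r / 2"] r in auto)
  moreover have "isCont (\<lambda>z. z - x) x"
    by simp
  ultimately have "isCont f' x"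
    unfolding f'_def by (rule isCont_o2[rotated])
  moreover have "\<forall>\<^sub>F y in nhds x. deriv f y = f' y"
    using eventually_nhds_in_open[OF open_ball, of x x r] r df
    by (auto elim!: eventually_mono)
  ultimately show "isCont (deriv f) x"
    by (simp add: isCont_cong)
qed

lemma real_analytic_on_lipschitz:
  assumes "real_analytic_on f U" "{m..M} \<subseteq> U"
  obtains L where "L \<ge> 0"
    and "\<And>x y. x \<in> {m..M} \<Longrightarrow> y \<in> {m..M} \<Longrightarrow> \<bar>f x - f y\<bar> \<le> L * \<bar>x - y\<bar>"
proof -
  have d: "(f has_real_derivative deriv f x) (at x)" "isCont (deriv f) x" if "x \<in> {m..M}" for x
    using real_analytic_on_deriv[OF assms(1)] assms(2) that by blast+
  have "continuous_on {m..M} (deriv f)"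
    using d(2) by (blast intro: continuous_at_imp_continuous_on)
  then have "bounded (deriv f ` {m..M})"
    by (intro compact_imp_bounded compact_continuous_image) auto
  then obtain L where L: "L > 0" "\<And>x. x \<in> {m..M} \<Longrightarrow> norm (deriv f x) \<le> L"
    by (auto simp: bounded_pos)
  show thesis
  proof
    show "L \<ge> 0" using L by simp
    show "\<bar>f x - f y\<bar> \<le> L * \<bar>x - y\<bar>" if "x \<in> {m..M}" "y \<in> {m..M}" for x y
      using field_differentiable_bound[of "{m..M}" f "deriv f" L x y]
        has_field_derivative_at_within[OF d(1)] L(2) that by simp
  qed
qed

lemma real_analytic_on_add:
  assumes "real_analytic_on f U" "real_analytic_on g V"
  shows "real_analytic_on (\<lambda>x. f x + g x) (U \<inter> V)"
  unfolding real_analytic_on_def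
proof
  fix x assume x: "x \<in> U \<inter> V"
  obtain r a where r: "r > 0" "\<And>y. y \<in> ball x r \<Longrightarrow> (\<lambda>n. a n * (y - x) ^ n) sums f y"
    using assms(1) x unfolding real_analytic_on_def by blast
  obtain s b where s: "s > 0" "\<And>y. y \<in> ball x s \<Longrightarrow> (\<lambda>n. b n * (y - x) ^ n) sums g y"
    using assms(2) x unfolding real_analytic_on_def by blast
  have "(\<lambda>n. (a n + b n) * (y - x) ^ n) sums (f y + g y)" if "y \<in> ball x (min r s)" for y
    using sums_add[OF r(2) s(2), of y] that by (simp add: algebra_simps)
  then show "\<exists>r>0. \<exists>a. \<forall>y\<in>ball x r. (\<lambda>n. a n * (y - x) ^ n) sums (f y + g y)"
    using r(1) s(1) by (intro exI[of _ "min r s"] conjI exI[of _ "\<lambda>n. a n + b n"]) auto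
qed

lemma real_analytic_on_const: "real_analytic_on (\<lambda>x. c) U"
  unfolding real_analytic_on_def
proof
  fix x :: real
  have "(\<lambda>n. (if n = 0 then c else 0) * (y - x) ^ n) sums c" for y
    using sums_single[of 0 "\<lambda>_. c"] by (rule sums_cong[THEN iffD1, rotated]) simp
  then show "\<exists>r>0. \<exists>a. \<forall>y\<in>ball x r. (\<lambda>n. a n * (y - x) ^ n) sums c"
    by (intro exI[of _ 1] conjI exI[of _ "\<lambda>n. if n = 0 then c else 0"]) auto
qed

lemma real_analytic_on_zero_near_limit_of_zeros:
  assumes f: "real_analytic_on f S" and "\<xi> \<in> S" and lim: "\<xi> islimpt {z \<in> S. f z = 0}"
  shows "\<exists>r>0. \<forall>y\<in>ball \<xi> r. f y = 0"
proof -
  obtain r a where r: "r > 0" and s: "\<And>y. y \<in> ball \<xi> r \<Longrightarrow> (\<lambda>n. a n * (y - \<xi>) ^ n) sums f y"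
    using f \<open>\<xi> \<in> S\<close> unfolding real_analytic_on_def by blast
  have fr: "\<exists>\<^sub>F z in at \<xi>. f z = 0"
    using lim unfolding islimpt_conv_frequently_at by (auto elim: frequently_elim1)
  have "f \<xi> = 0"
  proof (rule ccontr)
    assume "f \<xi> \<noteq> 0"
    moreover have "f \<midarrow>\<xi>\<rightarrow> f \<xi>"
      using DERIV_isCont[OF real_analytic_on_deriv(1)[OF f \<open>\<xi> \<in> S\<close>]] by (simp add: isCont_def)
    ultimately have "\<forall>\<^sub>F z in at \<xi>. f z \<noteq> 0"
      by (rule tendsto_imp_eventually_ne[rotated])
    with fr show False
      by (simp add: frequently_def)
  qed
  have a0: "a m = 0" if "m > 0" for m
  proof (rule ccontr)
    assume "a m \<noteq> 0"
    moreover have "(\<lambda>n. a n * (y - \<xi>) ^ n) sums f y" if "norm (y - \<xi>) < r" for y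
      using s that by (simp add: dist_norm norm_minus_commute)
    ultimately obtain t where t: "0 < t" "\<And>z. z \<in> cball \<xi> t - {\<xi>} \<Longrightarrow> f z \<noteq> 0"
      using powser_0_nonzero[of r \<xi> a f m] r \<open>f \<xi> = 0\<close> \<open>m > 0\<close> by metis
    then have "\<forall>\<^sub>F z in at \<xi>. f z \<noteq> 0"
      unfolding eventually_at by (intro exI[of _ t]) (auto simp: dist_commute)
    with fr show False
      by (simp add: frequently_def)
  qed
  have "a 0 = 0"
    using s[of \<xi>] r \<open>f \<xi> = 0\<close> by simp
  with a0 have "a = (\<lambda>_. 0)"
    by (metis gr0I)
  with s have "f y = 0" if "y \<in> ball \<xi> r" for y
    using that sums_unique2[of "\<lambda>n. 0" "f y" 0] by auto
  with r show ?thesis by blast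
qed

lemma real_analytic_on_identity:
  assumes f: "real_analytic_on f S" and S: "open S" "connected S"
    and \<xi>: "\<xi> \<in> S" "\<xi> islimpt {z \<in> S. f z = 0}" and "x \<in> S"
  shows "f x = 0"
proof -
  \<comment> \<open>The accumulation points of zeros are clopen in \<open>S\<close>.\<close>
  define A where "A = {x \<in> S. x islimpt {z \<in> S. f z = 0}}"
  have near: "\<exists>r>0. ball x r \<subseteq> S \<and> (\<forall>y\<in>ball x r. f y = 0)" if x: "x \<in> A" for x
  proof -
    obtain r where "r > 0" "\<And>y. y \<in> ball x r \<Longrightarrow> f y = 0"
      using real_analytic_on_zero_near_limit_of_zeros[OF f] x unfolding A_def by blast
    moreover obtain s where "s > 0" "ball x s \<subseteq> S"
      using \<open>open S\<close> x unfolding A_def open_contains_ball by blast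
    ultimately show ?thesis
      by (intro exI[of _ "min r s"]) auto
  qed
  have "open A"
    unfolding open_contains_ball
  proof
    fix x assume "x \<in> A"
    then obtain r where r: "r > 0" "ball x r \<subseteq> S" "\<And>y. y \<in> ball x r \<Longrightarrow> f y = 0"
      using near by blast
    have "y \<in> A" if y: "y \<in> ball x r" for y
    proof -
      have "y islimpt ball x r"
        using y by (intro interior_limit_point) simp
      moreover have "ball x r \<subseteq> {z \<in> S. f z = 0}"
        using r by blast
      ultimately show ?thesis
        using y r(2) unfolding A_def by (blast intro: islimpt_subset)
    qed
    with r show "\<exists>e>0. ball x e \<subseteq> A" by blast
  qed
  then have "openin (top_of_set S) A"
    by (intro open_subset) (auto simp: A_def)
  moreover have "closedin (top_of_set S) A"
    unfolding A_def using closedin_closed_Int[OF closed_limpts, of S "{z \<in> S. f z = 0}"]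
    by (simp add: Int_def)
  moreover have "A \<noteq> {}"
    using \<xi> by (auto simp: A_def)
  ultimately have "A = S"
    using S(2) unfolding connected_clopen by blast
  with \<open>x \<in> S\<close> obtain r where "r > 0" "\<And>y. y \<in> ball x r \<Longrightarrow> f y = 0"
    using near by blast
  then show ?thesis by simp
qed

section \<open>Legendre duality\<close>

text \<open>
  The real functions \<open>h\<close>, \<open>P\<close>, \<open>P'\<close> of the conclusion are the localized entropy, the pressure and
  its derivative. The equality at \<open>P' y\<close> holds because the tangent of the convex function \<open>P\<close> at
  \<open>y\<close> lies below its graph, so that \<open>P x - x * P' y\<close> is smallest at \<open>x = y\<close>.
\<close>

lemma legendre_dualityE:
  assumes "legendre_assumptions T \<psi>"
  obtains h P P' where
    "\<And>z. z \<in> rotation_set T \<psi> \<Longrightarrow> localized_entropy T \<psi> z = ereal (h z)"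
    "\<And>z y. z \<in> rotation_set T \<psi> \<Longrightarrow> h z \<le> P y - y * z"
    "\<And>y. h (P' y) = P y - y * P' y"
    "strict_mono P'" "continuous_on UNIV P'" "range P' = interior (rotation_set T \<psi>)"
    "real_analytic_on h (interior (rotation_set T \<psi>))"
proof -
  define R where "R = rotation_set T \<psi>"
  define h where "h z = real_of_ereal (localized_entropy T \<psi> z)" for z
  define P where "P y = real_of_ereal (linear_pressure T (\<lambda>p. y * \<psi> p))" for y
  define P' where "P' = deriv P"
  note A = assms[unfolded legendre_assumptions_def Let_def, folded R_def h_def P_def P'_def]
  from A have fin: "\<And>z. z \<in> R \<Longrightarrow> \<bar>localized_entropy T \<psi> z\<bar> \<noteq> \<infinity>"
    "\<And>y. \<bar>linear_pressure T (\<lambda>p. y * \<psi> p)\<bar> \<noteq> \<infinity>"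
    by auto
  from A have an: "real_analytic_on h (interior R)" "real_analytic_on P UNIV"
    and cx: "strictly_convex_on UNIV P" and inf: "\<And>z. z \<in> R \<Longrightarrow> localized_entropy T \<psi> z =
       (INF y. linear_pressure T (\<lambda>p. y * \<psi> p) - ereal (y * z))"
    by blast+
  from A obtain g where g: "homeomorphism UNIV (interior R) P' g"
    by blast
  have h: "localized_entropy T \<psi> z = ereal (h z)" if "z \<in> R" for z
    using fin(1)[OF that] by (simp add: h_def ereal_real)
  have P: "linear_pressure T (\<lambda>p. y * \<psi> p) = ereal (P y)" for y
    using fin(2)[of y] by (simp add: P_def ereal_real)
  have inf': "ereal (h z) = (INF y. ereal (P y - y * z))" if "z \<in> R" for z
    using inf[OF that] h[OF that] by (simp add: P)
  have le: "h z \<le> P y - y * z" if "z \<in> R" for z y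
  proof -
    have "ereal (h z) \<le> ereal (P y - y * z)"
      unfolding inf'[OF that] by (rule INF_lower) simp
    then show ?thesis by simp
  qed
  have conv: "convex_on UNIV P"
  proof (rule convex_onI)
    show "P ((1 - t) *\<^sub>R x + t *\<^sub>R y) \<le> (1 - t) * P x + t * P y" if "0 < t" "t < 1" for t x y
    proof (cases "x = y")
      case False
      then have "P ((1 - t) * x + t * y) < (1 - t) * P x + t * P y"
        using cx that unfolding strictly_convex_on_def by blast
      then show ?thesis by simp
    qed (simp add: algebra_simps)
  qed simp
  have der: "(P has_real_derivative P' y) (at y)" for y
    unfolding P'_def using real_analytic_on_deriv(1)[OF an(2)] by simp
  have tangent: "P' y * (x - y) \<le> P x - P y" for x y
    using convex_on_imp_above_tangent[OF conv, of y x "P' y"] der[of y] by simp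
  have rg: "range P' = interior R"
    using g by (simp add: homeomorphism_def)
  then have PR: "P' y \<in> R" for y
    using interior_subset by blast
  have "ereal (P y - y * P' y) \<le> ereal (h (P' y))" for y
    unfolding inf'[OF PR]
  proof (rule INF_greatest)
    show "ereal (P y - y * P' y) \<le> ereal (P x - x * P' y)" for x
      using tangent[of y x] by (simp add: algebra_simps)
  qed
  then have eq: "h (P' y) = P y - y * P' y" for y
    using le[OF PR[of y], of y] by (simp add: antisym)
  have "strict_mono P'"
  proof (rule strict_monoI)
    fix x y :: real assume "x < y"
    have "(P' y - P' x) * (y - x) \<ge> 0"
      using tangent[of x y] tangent[of y x] by (simp add: algebra_simps)
    with \<open>x < y\<close> have "P' x \<le> P' y"
      by (simp add: zero_le_mult_iff)
    moreover have "P' x \<noteq> P' y"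
      using g \<open>x < y\<close> by (metis UNIV_I homeomorphism_apply1 less_irrefl)
    ultimately show "P' x < P' y" by simp
  qed
  moreover have "continuous_on UNIV P'"
    using g by (simp add: homeomorphism_def)
  ultimately show thesis
    using that[of h P P'] h le eq rg an(1) unfolding R_def by blast
qed

lemma finite_maximizers:
  fixes h F P P' :: "real \<Rightarrow> real"
  assumes R: "R \<subseteq> {m..M}" "{m..M} \<subseteq> U" and F: "real_analytic_on F U"
    and h: "real_analytic_on h (interior R)"
    and le: "\<And>z y. z \<in> R \<Longrightarrow> h z \<le> P y - y * z"
    and eq: "\<And>y. h (P' y) = P y - y * P' y"
    and P': "strict_mono P'" "continuous_on UNIV P'" "range P' = interior R"
  defines "S \<equiv> {z \<in> R. \<forall>w\<in>R. h w + F w \<le> h z + F z}"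
  shows "finite S" and "S \<subseteq> interior R"
proof -
  obtain L where L: "L \<ge> 0"
    "\<And>x y. x \<in> {m..M} \<Longrightarrow> y \<in> {m..M} \<Longrightarrow> \<bar>F x - F y\<bar> \<le> L * \<bar>x - y\<bar>"
    using real_analytic_on_lipschitz[OF F R(2)] by blast
  have PI: "P' y \<in> interior R" for y
    using P'(3) by blast
  then have PR: "P' y \<in> R" for y
    using interior_subset by blast
  have slope: "h z \<le> h (P' y) + y * (P' y - z)" if "z \<in> R" for z y
    using le[OF that, of y] eq[of y] by (simp add: algebra_simps)
  have S_lower: "P' (- (L + 1)) \<le> z" if z: "z \<in> S" for z
  proof (rule ccontr)
    let ?w = "P' (- (L + 1))"
    assume "\<not> ?w \<le> z"
    then have zw: "z < ?w" by simp
    have zR: "z \<in> R" and "h ?w + F ?w \<le> h z + F z"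
      using z PR unfolding S_def by blast+
    moreover have "h z \<le> h ?w - (L + 1) * (?w - z)"
      using slope[OF zR, of "- (L + 1)"] by (simp add: algebra_simps)
    moreover have "F z - F ?w \<le> L * (?w - z)"
      using L(2)[of z ?w] zR PR R(1) zw by force
    ultimately show False
      using zw by (simp add: algebra_simps)
  qed
  have S_upper: "z \<le> P' (L + 1)" if z: "z \<in> S" for z
  proof (rule ccontr)
    let ?w = "P' (L + 1)"
    assume "\<not> z \<le> ?w"
    then have zw: "?w < z" by simp
    have zR: "z \<in> R" and "h ?w + F ?w \<le> h z + F z"
      using z PR unfolding S_def by blast+
    moreover have "h z \<le> h ?w - (L + 1) * (z - ?w)"
      using slope[OF zR, of "L + 1"] by (simp add: algebra_simps)
    moreover have "F z - F ?w \<le> L * (z - ?w)"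
      using L(2)[of z ?w] zR PR R(1) zw by force
    ultimately show False
      using zw by (simp add: algebra_simps)
  qed
  have conn: "connected (interior R)"
    unfolding P'(3)[symmetric] using P'(2) by (intro connected_continuous_image) auto
  let ?K = "{P' (- (L + 1))..P' (L + 1)}"
  have SK: "S \<subseteq> ?K"
    using S_lower S_upper by auto
  have KI: "?K \<subseteq> interior R"
    using connected_contains_Icc[OF conn PI PI] .
  show "S \<subseteq> interior R"
    using SK KI by blast
  show "finite S"
  proof (rule ccontr)
    assume inf: "infinite S"
    then obtain z0 where z0: "z0 \<in> S"
      using not_finite_existsD by fastforce
    define f where "f x = (h x + F x) + (- (h z0 + F z0))" for x
    have "real_analytic_on f ((interior R \<inter> U) \<inter> UNIV)"
      unfolding f_def by (intro real_analytic_on_add h F real_analytic_on_const)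
    moreover have "interior R \<subseteq> U"
      using R interior_subset by blast
    ultimately have f: "real_analytic_on f (interior R)"
      by (simp add: Int_absorb2)
    obtain \<xi> where \<xi>: "\<xi> \<in> ?K" "\<xi> islimpt S"
      using inf SK compact_Icc unfolding compact_eq_Bolzano_Weierstrass by meson
    have "f z = 0" if "z \<in> S" for z
    proof -
      have "h z + F z \<le> h z0 + F z0" "h z0 + F z0 \<le> h z + F z"
        using that z0 unfolding S_def by blast+
      then show ?thesis by (simp add: f_def)
    qed
    then have lim: "\<xi> islimpt {z \<in> interior R. f z = 0}"
      using \<xi>(2) SK KI by (intro islimpt_subset[OF \<xi>(2)]) auto
    \<comment> \<open>By strict monotonicity of \<open>P'\<close>, this interior point lies below every maximizer.\<close>
    have "f (P' (- (L + 2))) = 0"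
      using real_analytic_on_identity[OF f open_interior conn _ lim PI] \<xi>(1) KI by blast
    then have "P' (- (L + 2)) \<in> S"
      using z0 PR unfolding S_def f_def by auto
    then have "P' (- (L + 1)) \<le> P' (- (L + 2))"
      by (rule S_lower)
    then show False
      using strict_monoD[OF P'(1), of "- (L + 2)" "- (L + 1)"] by simp
  qed
qed

section \<open>Two-coordinate distributions\<close>

lemma AE_in_closed_superset_of_support:
  fixes \<nu> :: "'a::second_countable_topology measure"
  assumes sets: "sets \<nu> = sets borel" and "closed C" "measure_support \<nu> \<subseteq> C"
  shows "AE x in \<nu>. x \<in> C"
proof -
  let ?F = "{U. open U \<and> emeasure \<nu> U = 0}"
  obtain F' where F': "F' \<subseteq> ?F" "countable F'" "\<Union>F' = \<Union>?F"
    using Lindelof[of ?F] by blast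
  have "\<Union>F' \<in> null_sets \<nu>"
    using F' by (intro null_sets_UN'[of F' id \<nu>, simplified]) (auto simp: null_sets_def sets)
  moreover have "- C \<subseteq> \<Union>F'"
  proof
    \<comment> \<open>By the Lindelof property, the complement of the support is a countable union of null sets.\<close>
    fix x assume "x \<in> - C"
    then have "x \<notin> measure_support \<nu>"
      using assms(3) by blast
    then obtain U where "open U" "x \<in> U" "emeasure \<nu> U = 0"
      by (auto simp: measure_support_def)
    then show "x \<in> \<Union>F'"
      unfolding F'(3) by blast
  qed
  ultimately show ?thesis
    by (intro AE_I') auto
qed

text \<open>The joint law of two consecutive states, as a measure on the whole product space.\<close>

abbreviation joint_law ::
    "'a::topological_space measure \<Rightarrow> ('a \<Rightarrow> 'a measure) \<Rightarrow> ('a \<times> 'a) measure" where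
  "joint_law \<mu> Q \<equiv> \<mu> \<bind> (\<lambda>x. distr (Q x) borel (\<lambda>y. (x, y)))"

lemma measurable_joint_kernel:
  fixes Q :: "'a::second_countable_topology \<Rightarrow> 'a measure"
  assumes "Q \<in> borel \<rightarrow>\<^sub>M prob_algebra borel"
  shows "(\<lambda>x. distr (Q x) borel (\<lambda>y. (x, y))) \<in> borel \<rightarrow>\<^sub>M prob_algebra borel"
proof (rule measurable_distr_prob_space2[OF assms])
  show "(\<lambda>(x, y). (x, y)) \<in> borel \<Otimes>\<^sub>M borel \<rightarrow>\<^sub>M (borel :: ('a \<times> 'a) measure)"
    by (simp add: borel_prod)
qed

lemma stationary_pairsD:
  assumes "(\<mu>, Q) \<in> stationary_pairs T"
  shows "Q \<in> borel \<rightarrow>\<^sub>M prob_algebra borel" "\<And>x. measure_support (Q x) \<subseteq> T x"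
    "\<mu> \<in> space (prob_algebra borel)" "prob_space \<mu>" "sets \<mu> = sets borel"
  using assms unfolding stationary_pairs_def transition_kernels_def borel_probs_def
  by (auto simp: space_prob_algebra)

lemma two_coord_in_borel_probs:
  fixes T :: "'a::second_countable_topology \<Rightarrow> 'a set"
  assumes T: "correspondence T" and pair: "(\<mu>, Q) \<in> stationary_pairs T"
  shows "two_coord T \<mu> Q \<in> borel_probs (graph T)"
proof -
  note p = stationary_pairsD[OF pair]
  let ?J = "joint_law \<mu> Q"
  have K: "(\<lambda>x. distr (Q x) borel (\<lambda>y. (x, y))) \<in> borel \<rightarrow>\<^sub>M prob_algebra borel"
    by (rule measurable_joint_kernel[OF p(1)])
  have K': "(\<lambda>x. distr (Q x) borel (\<lambda>y. (x, y))) \<in> \<mu> \<rightarrow>\<^sub>M subprob_algebra borel"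
    using measurable_prob_algebraD[OF K] p(5) by (simp cong: measurable_cong_sets)
  interpret J: prob_space ?J
    by (rule prob_space_bind'[OF p(3) K])
  have sJ: "sets ?J = sets borel"
    by (rule sets_bind'[OF p(3) K])
  have closed: "closed (graph T)" "closed (T x)" for x
    using T by (auto simp: correspondence_def)
  have sQ: "sets (Q x) = sets borel" for x
    using measurable_space[OF p(1), of x] by (simp add: space_prob_algebra)
  have "AE z in distr (Q x) borel (\<lambda>y. (x, y)). z \<in> graph T" for x
  proof -
    have "(\<lambda>y. (x, y)) \<in> Q x \<rightarrow>\<^sub>M borel"
      unfolding measurable_cong_sets[OF sQ refl] borel_prod[symmetric] by measurable
    moreover have "{z \<in> space borel. z \<in> graph T} \<in> sets borel"
      using closed(1) by simp
    ultimately show ?thesis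
      using AE_in_closed_superset_of_support[OF sQ closed(2) p(2)]
      by (simp add: AE_distr_iff graph_def)
  qed
  then have "AE z in ?J. z \<in> graph T"
    using pred_sets2[OF borel_closed[OF closed(1)], of id borel] by (subst AE_bind[OF K']) auto
  then have "emeasure ?J (graph T) = 1"
    using closed(1) J.emeasure_eq_1_AE sJ by simp
  then have "prob_space (two_coord T \<mu> Q)"
    unfolding two_coord_def using closed(1) sJ by (intro prob_space_restrict_space) simp_all
  then show ?thesis
    unfolding borel_probs_def two_coord_def
    using sJ by (simp cong: sets_restrict_space_cong)
qed

lemma two_coord_cong_pair_equiv:
  fixes T :: "'a::second_countable_topology \<Rightarrow> 'a set"
  assumes "((\<mu>, Q), (\<mu>', Q')) \<in> pair_equiv T"
  shows "two_coord T \<mu> Q = two_coord T \<mu>' Q'"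
proof -
  have pairs: "(\<mu>, Q) \<in> stationary_pairs T" "(\<mu>', Q') \<in> stationary_pairs T"
    and eq: "\<mu> = \<mu>'" "AE x in \<mu>. Q x = Q' x"
    using assms by (auto simp: pair_equiv_def)
  have "AE x in \<mu>. distr (Q x) borel (\<lambda>y. (x, y)) = distr (Q' x) borel (\<lambda>y. (x, y))"
    using eq(2) by (rule eventually_mono) simp
  then have "joint_law \<mu> Q = joint_law \<mu> Q'"
    by (rule bind_cong_AE'[OF stationary_pairsD(3)[OF pairs(1)]
        measurable_joint_kernel[OF stationary_pairsD(1)[OF pairs(1)]]
        measurable_joint_kernel[OF stationary_pairsD(1)[OF pairs(2)]]])
  then show ?thesis
    by (simp add: two_coord_def eq(1))
qed

lemma integral_in_range_borel_probs:
  fixes \<psi> :: "'a::topological_space \<Rightarrow> real"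
  assumes "\<gamma> \<in> borel_probs G" "continuous_on G \<psi>" "\<And>p. p \<in> G \<Longrightarrow> \<psi> p \<in> {m..M}"
  shows "(\<integral>p. \<psi> p \<partial>\<gamma>) \<in> {m..M}"
proof -
  have s: "sets \<gamma> = sets (restrict_space borel G)"
    using assms(1) by (simp add: borel_probs_def)
  interpret prob_space \<gamma>
    using assms(1) by (simp add: borel_probs_def)
  have sp: "space \<gamma> = G"
    using sets_eq_imp_space_eq[OF s] by (simp add: space_restrict_space)
  have "\<psi> \<in> borel_measurable \<gamma>"
    using borel_measurable_continuous_on_restrict[OF assms(2)] s
    by (simp cong: measurable_cong_sets)
  moreover have "AE p in \<gamma>. norm (\<psi> p) \<le> max \<bar>m\<bar> \<bar>M\<bar>"
    using assms(3) by (intro AE_I2) (fastforce simp: sp)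
  ultimately have "integrable \<gamma> \<psi>"
    by (intro integrable_const_bound)
  moreover have "AE p in \<gamma>. m \<le> \<psi> p" "AE p in \<gamma>. \<psi> p \<le> M"
    using assms(3) by (auto intro!: AE_I2 simp: sp)
  ultimately show ?thesis
    using integral_ge_const integral_le_const by auto
qed

section \<open>Equilibrium pairs\<close>

lemma kernel_entropy_le_localized_entropy:
  assumes "(\<mu>, Q) \<in> stationary_pairs T"
  shows "kernel_entropy \<mu> Q \<le> localized_entropy T \<psi> (rotation_value T \<psi> (\<mu>, Q))"
  unfolding localized_entropy_def using assms
  by (intro SUP_upper2[of "(\<mu>, Q)"]) auto

lemma equiv_pair_equiv:
  fixes T :: "'a::topological_space \<Rightarrow> 'a set"
  shows "equiv (stationary_pairs T) (pair_equiv T)"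
proof (rule equivI)
  show "pair_equiv T \<subseteq> stationary_pairs T \<times> stationary_pairs T"
    by (auto simp: pair_equiv_def)
  show "refl_on (stationary_pairs T) (pair_equiv T)"
    by (auto simp: refl_on_def pair_equiv_def)
  show "sym (pair_equiv T)"
    by (rule symI) (auto simp: pair_equiv_def eq_commute)
  have "AE x in \<mu>. Q x = Q'' x" if "AE x in \<mu>. Q x = Q' x" "AE x in \<mu>. Q' x = Q'' x"
    for \<mu> :: "'a measure" and Q Q' Q'' :: "'a \<Rightarrow> 'a measure"
    using that by eventually_elim simp
  then show "trans (pair_equiv T)"
    by (intro transI) (auto simp: pair_equiv_def)
qed

text \<open>
  Here \<open>c\<close> plays the role of the pressure of \<open>y \<psi>\<close>. The bound \<open>h w \<le> c - y w\<close> shows that \<open>c\<close>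
  dominates the entropy plus \<open>y\<close> times the rotation value of every stationary pair, and the given
  pair attains \<open>c\<close>.
\<close>

lemma linear_equilibrium_pairsI:
  assumes h: "\<And>w. w \<in> rotation_set T \<psi> \<Longrightarrow> localized_entropy T \<psi> w = ereal (h w)"
    and le: "\<And>w. w \<in> rotation_set T \<psi> \<Longrightarrow> h w \<le> c - y * w"
    and pair: "(\<mu>, Q) \<in> stationary_pairs T"
    and eq: "kernel_entropy \<mu> Q = ereal (c - y * rotation_value T \<psi> (\<mu>, Q))"
  shows "(\<mu>, Q) \<in> linear_equilibrium_pairs T (\<lambda>p. y * \<psi> p)"
proof -
  have int: "(\<integral>p. y * \<psi> p \<partial>two_coord T \<mu> Q) = y * rotation_value T \<psi> (\<mu>, Q)" for \<mu> Q
    by (simp add: rotation_value_def)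
  have "kernel_entropy \<mu>' Q' + ereal (y * rotation_value T \<psi> (\<mu>', Q')) \<le> ereal c"
    if "(\<mu>', Q') \<in> stationary_pairs T" for \<mu>' Q'
  proof -
    let ?w = "rotation_value T \<psi> (\<mu>', Q')"
    have w: "?w \<in> rotation_set T \<psi>"
      using that by (auto simp: rotation_set_def)
    have "kernel_entropy \<mu>' Q' \<le> ereal (h ?w)"
      using kernel_entropy_le_localized_entropy[OF that, of \<psi>] h[OF w] by simp
    also have "\<dots> \<le> ereal (c - y * ?w)"
      using le[OF w] by simp
    finally show ?thesis
      using add_right_mono[of "kernel_entropy \<mu>' Q'" "ereal (c - y * ?w)" "ereal (y * ?w)"]
      by simp
  qed
  moreover have "kernel_entropy \<mu> Q + ereal (y * rotation_value T \<psi> (\<mu>, Q)) = ereal c"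
    by (simp add: eq)
  ultimately have "kernel_entropy \<mu> Q + ereal (y * rotation_value T \<psi> (\<mu>, Q)) =
      (SUP (\<mu>', Q')\<in>stationary_pairs T.
         kernel_entropy \<mu>' Q' + ereal (y * rotation_value T \<psi> (\<mu>', Q')))"
    by (intro antisym SUP_upper2[OF pair] SUP_least) auto
  then show ?thesis
    using pair by (simp only: linear_equilibrium_pairs_def int mem_Collect_eq prod.case simp_thms)
qed

lemma nonlinear_equilibrium_pairsD:
  assumes E: "\<And>\<mu> Q. (\<mu>, Q) \<in> stationary_pairs T \<Longrightarrow>
      E (two_coord T \<mu> Q) = F (rotation_value T \<psi> (\<mu>, Q))"
    and h: "\<And>z. z \<in> rotation_set T \<psi> \<Longrightarrow> localized_entropy T \<psi> z = ereal (h z)"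
    and pair: "(\<mu>, Q) \<in> nonlinear_equilibrium_pairs T E"
  defines "z \<equiv> rotation_value T \<psi> (\<mu>, Q)"
  shows "kernel_entropy \<mu> Q = ereal (h z)"
    and "\<And>w. w \<in> rotation_set T \<psi> \<Longrightarrow> h w + F w \<le> h z + F z"
proof -
  have st: "(\<mu>, Q) \<in> stationary_pairs T"
    using pair by (simp add: nonlinear_equilibrium_pairs_def)
  have max: "kernel_entropy \<mu>' Q' + ereal (F (rotation_value T \<psi> (\<mu>', Q')))
      \<le> kernel_entropy \<mu> Q + ereal (F z)" if "(\<mu>', Q') \<in> stationary_pairs T" for \<mu>' Q'
  proof -
    have "kernel_entropy \<mu>' Q' + ereal (E (two_coord T \<mu>' Q'))
        \<le> kernel_entropy \<mu> Q + ereal (E (two_coord T \<mu> Q))"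
      using pair that unfolding nonlinear_equilibrium_pairs_def by blast
    then show ?thesis
      unfolding E[OF that] E[OF st] z_def .
  qed
  have z: "z \<in> rotation_set T \<psi>"
    using st by (auto simp: rotation_set_def z_def)
  have up: "localized_entropy T \<psi> w \<le> kernel_entropy \<mu> Q + ereal (F z - F w)" for w
    unfolding localized_entropy_def
  proof (rule SUP_least, clarify)
    fix \<mu>' Q' assume "(\<mu>', Q') \<in> stationary_pairs T" "w = rotation_value T \<psi> (\<mu>', Q')"
    with max[of \<mu>' Q'] have "kernel_entropy \<mu>' Q' + ereal (F w) \<le> kernel_entropy \<mu> Q + ereal (F z)"
      by simp
    then show "kernel_entropy \<mu>' Q'
        \<le> kernel_entropy \<mu> Q + ereal (F z - F (rotation_value T \<psi> (\<mu>', Q')))"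
      using \<open>w = _\<close>
      by (cases "kernel_entropy \<mu>' Q'"; cases "kernel_entropy \<mu> Q") auto
  qed
  show ent: "kernel_entropy \<mu> Q = ereal (h z)"
    using up[of z] kernel_entropy_le_localized_entropy[OF st, of \<psi>] h[OF z]
    by (simp add: z_def antisym flip: zero_ereal_def)
  show "h w + F w \<le> h z + F z" if "w \<in> rotation_set T \<psi>" for w
    using up[of w] by (simp add: ent h[OF that])
qed

theorem theoremD:
  fixes T :: "'a::polish_space \<Rightarrow> 'a set"
    and \<psi> :: "'a \<times> 'a \<Rightarrow> real"
    and F :: "real \<Rightarrow> real"
    and U :: "real set"
    and E :: "('a \<times> 'a) measure \<Rightarrow> real"
  assumes "compact (UNIV :: 'a set)"
    and "correspondence T"
    and "forward_expansive T"
    and "continuous_on (graph T) \<psi>"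
    and "legendre_assumptions T \<psi>"
    and "unique_linear_equilibrium_pairs T \<psi>"
    and "open U"
    and "convex hull (\<psi> ` graph T) \<subseteq> U"
    and "real_analytic_on F U"
    and "\<And>\<gamma>. \<gamma> \<in> borel_probs (graph T) \<Longrightarrow> E \<gamma> = F (\<integral>p. \<psi> p \<partial>\<gamma>)"
    and "abundance_of_ergodic_path_measures T E"
  shows "finite (rotation_value T \<psi> ` nonlinear_equilibrium_pairs T E) \<and>
         finite (nonlinear_equilibrium_pairs T E // pair_equiv T) \<and>
         finite ((\<lambda>(\<mu>, Q). two_coord T \<mu> Q) ` nonlinear_equilibrium_pairs T E)"
proof -
  let ?R = "rotation_set T \<psi>" and ?N = "nonlinear_equilibrium_pairs T E"
  obtain h P P' where h: "\<And>z. z \<in> ?R \<Longrightarrow> localized_entropy T \<psi> z = ereal (h z)"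
    and le: "\<And>z y. z \<in> ?R \<Longrightarrow> h z \<le> P y - y * z"
    and eq: "\<And>y. h (P' y) = P y - y * P' y"
    and P': "strict_mono P'" "continuous_on UNIV P'" "range P' = interior ?R"
    and h_an: "real_analytic_on h (interior ?R)"
    using legendre_dualityE[OF assms(5)] by metis
  have E: "E (two_coord T \<mu> Q) = F (rotation_value T \<psi> (\<mu>, Q))"
    if "(\<mu>, Q) \<in> stationary_pairs T" for \<mu> Q
    using assms(10)[OF two_coord_in_borel_probs[OF assms(2) that]] by (simp add: rotation_value_def)

  have "graph T \<noteq> {}"
    using assms(2) by (auto simp: correspondence_def graph_def)
  moreover have "compact (UNIV \<inter> graph T)"
    using compact_Times[OF assms(1,1)] assms(2)
    by (intro compact_Int_closed) (auto simp: correspondence_def)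
  ultimately obtain p q where pq: "p \<in> graph T" "q \<in> graph T"
    "\<And>x. x \<in> graph T \<Longrightarrow> \<psi> x \<in> {\<psi> p..\<psi> q}"
    using continuous_attains_inf[of "graph T" \<psi>] continuous_attains_sup[of "graph T" \<psi>] assms(4)
    by (metis Int_UNIV_left atLeastAtMost_iff)
  have R_bound: "?R \<subseteq> {\<psi> p..\<psi> q}"
    using integral_in_range_borel_probs[OF two_coord_in_borel_probs[OF assms(2)] assms(4) pq(3)]
    by (auto simp: rotation_set_def rotation_value_def)
  have "\<psi> p \<le> \<psi> q"
    using pq(3)[OF pq(1)] by simp
  moreover have "closed_segment (\<psi> p) (\<psi> q) \<subseteq> convex hull (\<psi> ` graph T)"
    using pq(1,2) by (intro closed_segment_subset_convex_hull hull_inc) auto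
  ultimately have "{\<psi> p..\<psi> q} \<subseteq> U"
    using assms(8) by (simp add: closed_segment_eq_real_ivl)
  note max = finite_maximizers[OF R_bound this assms(9) h_an le eq P']
  define S where "S = {z \<in> ?R. \<forall>w\<in>?R. h w + F w \<le> h z + F z}"
  have S: "finite S" "S \<subseteq> interior ?R"
    using max unfolding S_def by blast+

  have st: "?N \<subseteq> stationary_pairs T"
    by (auto simp: nonlinear_equilibrium_pairs_def)
  have N_S: "rotation_value T \<psi> (\<mu>, Q) \<in> S" if "(\<mu>, Q) \<in> ?N" for \<mu> Q
  proof -
    have "rotation_value T \<psi> (\<mu>, Q) \<in> ?R"
      using that st by (auto simp: rotation_set_def)
    moreover have "h w + F w \<le> h (rotation_value T \<psi> (\<mu>, Q)) + F (rotation_value T \<psi> (\<mu>, Q))"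
      if "w \<in> ?R" for w
      by (rule nonlinear_equilibrium_pairsD(2)[where T = T and E = E])
        (use E h that \<open>(\<mu>, Q) \<in> ?N\<close> in auto)
    ultimately show ?thesis
      by (simp add: S_def)
  qed
  then have "rotation_value T \<psi> ` ?N \<subseteq> S"
    by auto
  then have fin1: "finite (rotation_value T \<psi> ` ?N)"
    using S(1) by (rule finite_subset)

  let ?L = "\<lambda>y. linear_equilibrium_pairs T (\<lambda>p. y * \<psi> p)"
  have N_L: "(\<mu>, Q) \<in> ?L y"
    if N: "(\<mu>, Q) \<in> ?N" and y: "rotation_value T \<psi> (\<mu>, Q) = P' y" for \<mu> Q y
  proof (rule linear_equilibrium_pairsI[where h = h and c = "P y"])
    have "kernel_entropy \<mu> Q = ereal (h (rotation_value T \<psi> (\<mu>, Q)))"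
      by (rule nonlinear_equilibrium_pairsD(1)[where T = T and E = E and F = F]) (use E h N in auto)
    then show "kernel_entropy \<mu> Q = ereal (P y - y * rotation_value T \<psi> (\<mu>, Q))"
      by (simp add: eq y)
  qed (use N st h le in auto)
  have y: "P' (inv P' z) = z" if "z \<in> S" for z
    using S(2) that unfolding P'(3)[symmetric] by (intro f_inv_into_f) auto
  have "?N \<subseteq> (\<Union>z\<in>S. ?L (inv P' z))"
  proof clarify
    fix \<mu> Q assume N: "(\<mu>, Q) \<in> ?N"
    show "(\<mu>, Q) \<in> (\<Union>z\<in>S. ?L (inv P' z))"
      using N_S[OF N] N_L[OF N y[OF N_S[OF N], symmetric]] by (rule UN_I)
  qed
  then have "?N // pair_equiv T \<subseteq> (\<Union>z\<in>S. ?L (inv P' z) // pair_equiv T)"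
    unfolding quotient_def by blast
  moreover have "finite (\<Union>z\<in>S. ?L (inv P' z) // pair_equiv T)"
    using S(1)
  proof (rule finite_UN_I)
    show "finite (?L (inv P' z) // pair_equiv T)" for z
      using assms(6) by (intro card_ge_0_finite) (simp add: unique_linear_equilibrium_pairs_def)
  qed
  ultimately have fin2: "finite (?N // pair_equiv T)"
    by (rule finite_subset)

  let ?c = "\<lambda>(\<mu>, Q). two_coord T \<mu> Q"
  have "?c p = ?c (SOME q. q \<in> pair_equiv T `` {p})" if "p \<in> ?N" for p
  proof -
    have "p \<in> pair_equiv T `` {p}"
      using that st equiv_class_self[OF equiv_pair_equiv] by blast
    then have "(SOME q. q \<in> pair_equiv T `` {p}) \<in> pair_equiv T `` {p}"
      by (rule someI)
    then have "(p, SOME q. q \<in> pair_equiv T `` {p}) \<in> pair_equiv T"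
      by simp
    then show ?thesis
      by (cases p; cases "SOME q. q \<in> pair_equiv T `` {p}")
        (simp add: two_coord_cong_pair_equiv)
  qed
  then have "?c ` ?N \<subseteq> (\<lambda>C. ?c (SOME q. q \<in> C)) ` (?N // pair_equiv T)"
    by (auto intro!: image_subsetI image_eqI[OF _ quotientI] simp del: Image_singleton_iff)
  then have "finite (?c ` ?N)"
    using fin2 finite_surj by blast
  with fin1 fin2 show ?thesis by blast
qed

end
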